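(* For $p\in(0,1)$, $\sigma\in(0,\infty)$ and $\mu\in\mathbb{R}$, put $\alpha=\sqrt{\frac{p}{1-p}}$ and $\beta=\frac{2\alpha}{\sigma(\alpha^2+1)}$, and define $$\psi(x;\mu,\sigma,p)=\begin{cases}\beta\,\Phi\left(\frac{x-\mu}{\sigma\alpha^{-1}}\right), & x\ge\mu,\\ \beta\,\Phi\left(\frac{x-\mu}{\sigma\alpha}\right), & x<\mu,\end{cases}$$ where $\Phi(\xi)=\frac{1}{\sqrt{2\pi}}\exp\left(-\frac12\xi^2\right)$. Then $\psi$ is the density of a constrained mixture of the normal distribution split at its mode; that is, it satisfies all four constraints (Continuity, Mixture, Volume, Weighting): 1. (Continuity) $\lim_{x\to\mu^+}\psi(x;\mu,\sigma,p)=\lim_{x\to\mu^-}\psi(x;\mu,\sigma,p)$ for all $\mu,\sigma,p$. 2. (Mixture) There are functions $\Theta_\pm:\mathbb{R}\times(0,\infty)\times(0,1)\to\mathbb{R}\times(0,\infty)$ and a constant $Z\in(0,\infty)$ such that for all $x\in\mathbb{R}$ and all $\mu,\sigma,p$, $$\psi(x;\mu,\sigma,p)\,Z=p\,\phi(x;\Theta_-(\mu,\sigma,p))\,\mathbb{I}[x<\mu]+(1-p)\,\phi(x;\Theta_+(\mu,\sigma,p))\,\mathbb{I}[x\ge\mu].$$ 3. (Volume) $\int_{-\infty}^{\infty}\psi(x;\mu,\sigma,p)\,dx=1$ for all $\mu,\sigma,p$. 4. (Weighting) $\int_{-\infty}^{\mu}\psi(x;\mu,\sigma,p)\,dx=p$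 for all $\mu,\sigma,p$.
   Context: The normal density with parameters $(\mu,\sigma)\in\mathbb{R}\times(0,\infty)$ is $\phi(x;\mu,\sigma)=\frac{1}{\sigma}\Phi\left(\frac{x-\mu}{\sigma}\right)$, where $\Phi$ denotes the standard normal density (not the distribution function). $\mathbb{I}[\cdot]$ is the indicator function. A constrained mixture built from a base density is a density that is continuous at a split point $\mu$, and on each side of $\mu$ is (up to one common normalizing constant $Z$) the base density with suitable parameters given by the functions $\Theta_\pm$, with weights $p$ on the left and $1-p$ on the right. The split point is taken to be the mode $\mu$ of the base distribution, so the same symbol $\mu$ is used for both. *)

theory Defs
  imports "HOL-Probability.Probability"
begin

definition phi :: "real \<Rightarrow> real \<times> real \<Rightarrow> real" where
  "phi x = (\<lambda>(\<mu>, \<sigma>). 1 / \<sigma> * std_normal_density ((x - \<mu>) / \<sigma>))"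

lemma phi_eq_normal_density:
  assumes "\<sigma> > 0"
  shows "phi x (\<mu>, \<sigma>) = normal_density \<mu> \<sigma> x"
  using assms
  by (simp add: phi_def normal_density_def real_sqrt_mult power_divide field_simps)

definition alpha :: "real \<Rightarrow> real" where
  "alpha p = sqrt (p / (1 - p))"

definition beta :: "real \<Rightarrow> real \<Rightarrow> real" where
  "beta \<sigma> p = 2 * alpha p / (\<sigma> * ((alpha p)\<^sup>2 + 1))"

definition psi :: "real \<Rightarrow> real \<Rightarrow> real \<Rightarrow> real \<Rightarrow> real" where
  "psi \<mu> \<sigma> p x =
     (if x \<ge> \<mu>
      then beta \<sigma> p * std_normal_density ((x - \<mu>) / (\<sigma> * inverse (alpha p)))
      else beta \<sigma> p * std_normal_density ((x - \<mu>) / (\<sigma> * alpha p)))"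

end

theory Submission
  imports Defs
begin

text \<open>
  Since \<open>\<alpha>\<^sup>2 + 1 = 1 / (1 - p)\<close>, the function \<open>\<psi>\<close> equals \<open>2 p\<close> times the normal density with
  deviation \<open>\<sigma> \<alpha>\<close> left of \<open>\<mu>\<close>, and \<open>2 (1 - p)\<close> times the one with deviation \<open>\<sigma> / \<alpha>\<close> right of
  \<open>\<mu>\<close>. This is the mixture identity with \<open>Z = 1 / 2\<close>, and as a normal density has mass \<open>1 / 2\<close> on
  either side of its mode, the two sides carry the masses \<open>p\<close> and \<open>1 - p\<close>.
\<close>

text \<open>An affine substitution carries \<open>gaussian_moment_0\<close>, the integral of
  \<open>exp (- x\<^sup>2)\<close> over the positive half-line, to the normal density. The sign
  \<epsilon> selects the side of \<mu>, so one computation covers both halves.\<close>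

lemma has_bochner_integral_normal_density_half:
  assumes "\<sigma> > 0" and "\<epsilon> = 1 \<or> \<epsilon> = -1"
  shows "has_bochner_integral lborel
    (\<lambda>x. indicator {0..} (\<epsilon> * (x - \<mu>)) * normal_density \<mu> \<sigma> x) (1 / 2)"
proof -
  \<comment> \<open>Slope of the substitution y = c (x - \<mu>), chosen so that
    \<open>y\<^sup>2\<close> is the exponent
    \<open>(x - \<mu>)\<^sup>2 / (2 * \<sigma>\<^sup>2)\<close>; the sign of \<open>c\<close> is
    that of \<epsilon>.\<close>
  define c where "c = \<epsilon> / (sqrt 2 * \<sigma>)"
  have c: "c \<noteq> 0" "\<bar>c\<bar> = 1 / (sqrt 2 * \<sigma>)" "c\<^sup>2 = 1 / (2 * \<sigma>\<^sup>2)"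
    using assms by (auto simp: c_def power_divide power_mult_distrib)
  have "has_bochner_integral lborel
      (\<lambda>x. indicator {0..} (- (c * \<mu>) + c * x) *\<^sub>R exp (- (- (c * \<mu>) + c * x)\<^sup>2))
      ((sqrt pi / 2) /\<^sub>R \<bar>c\<bar>)"
    using gaussian_moment_0
    by (rule lborel_has_bochner_integral_real_affine_iff[OF c(1), THEN iffD1])
  then have "has_bochner_integral lborel
      (\<lambda>x. 1 / sqrt (2 * pi * \<sigma>\<^sup>2) *
        (indicator {0..} (- (c * \<mu>) + c * x) *\<^sub>R exp (- (- (c * \<mu>) + c * x)\<^sup>2)))
      (1 / sqrt (2 * pi * \<sigma>\<^sup>2) * ((sqrt pi / 2) /\<^sub>R \<bar>c\<bar>))"
    by (rule has_bochner_integral_mult_right)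
  moreover have "1 / sqrt (2 * pi * \<sigma>\<^sup>2) * ((sqrt pi / 2) /\<^sub>R \<bar>c\<bar>) = 1 / 2"
    using assms(1) by (simp add: c real_sqrt_mult field_simps)
  moreover have "1 / sqrt (2 * pi * \<sigma>\<^sup>2) *
      (indicator {0..} (- (c * \<mu>) + c * x) *\<^sub>R exp (- (- (c * \<mu>) + c * x)\<^sup>2)) =
      indicator {0..} (\<epsilon> * (x - \<mu>)) * normal_density \<mu> \<sigma> x" for x
  proof -
    have affine: "- (c * \<mu>) + c * x = c * (x - \<mu>)"
      by (simp add: algebra_simps)
    have "c * (x - \<mu>) = \<epsilon> * (x - \<mu>) / (sqrt 2 * \<sigma>)"
      by (simp add: c_def)
    moreover have "sqrt 2 * \<sigma> > 0"
      using assms(1) by simp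
    \<comment> \<open>The two quantities differ by the positive factor
      \<open>sqrt 2 * \<sigma>\<close>, so the indicator sees the same sign.\<close>
    ultimately have "0 \<le> c * (x - \<mu>) \<longleftrightarrow> 0 \<le> \<epsilon> * (x - \<mu>)"
      by (metis divide_nonneg_pos divide_neg_pos not_le)
    moreover have "(c * (x - \<mu>))\<^sup>2 = (x - \<mu>)\<^sup>2 / (2 * \<sigma>\<^sup>2)"
      by (simp add: power_mult_distrib c(3))
    ultimately show ?thesis
      unfolding affine by (simp add: normal_density_def indicator_def)
  qed
  ultimately show ?thesis
    by (simp only:)
qed

lemma has_bochner_integral_normal_density_atMost:
  assumes "\<sigma> > 0"
  shows "has_bochner_integral lborel (\<lambda>x. indicator {..\<mu>} x * normal_density \<mu> \<sigma> x) (1 / 2)"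
proof -
  have "indicator {0..} (-1 * (x - \<mu>)) = (indicator {..\<mu>} x :: real)" for x
    by (simp add: indicator_def)
  then show ?thesis
    using has_bochner_integral_normal_density_half[OF assms, of "-1" \<mu>] by simp
qed

lemma has_bochner_integral_normal_density_atLeast:
  assumes "\<sigma> > 0"
  shows "has_bochner_integral lborel (\<lambda>x. indicator {\<mu>..} x * normal_density \<mu> \<sigma> x) (1 / 2)"
proof -
  have "indicator {0..} (1 * (x - \<mu>)) = (indicator {\<mu>..} x :: real)" for x
    by (simp add: indicator_def)
  then show ?thesis
    using has_bochner_integral_normal_density_half[OF assms, of 1 \<mu>] by simp
qed

lemma alpha_pos: "p \<in> {0<..<1} \<Longrightarrow> alpha p > 0"
  by (simp add: alpha_def)

lemma beta_eq:
  assumes "p \<in> {0<..<1}"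
  shows "beta \<sigma> p = 2 * alpha p * (1 - p) / \<sigma>"
proof -
  have "(alpha p)\<^sup>2 + 1 = 1 / (1 - p)"
    using assms by (simp add: alpha_def field_simps)
  then show ?thesis
    by (simp add: beta_def)
qed

text \<open>The common height \<open>beta\<close> factors in two ways: as \<open>2 * (1 - p)\<close>
  times the factor 1 / deviation of the right branch, and as \<open>2 * p\<close> times that of the
  left branch.\<close>

lemma psi_eq_phi:
  assumes "\<sigma> > 0" "p \<in> {0<..<1}"
  shows "psi \<mu> \<sigma> p x =
    (if x \<ge> \<mu> then 2 * (1 - p) * phi x (\<mu>, \<sigma> / alpha p) else 2 * p * phi x (\<mu>, \<sigma> * alpha p))"
proof -
  have right: "beta \<sigma> p = 2 * (1 - p) * (1 / (\<sigma> / alpha p))"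
    using assms by (simp add: beta_eq)
  have left: "beta \<sigma> p = 2 * p * (1 / (\<sigma> * alpha p))"
  proof -
    \<comment> \<open>The definition of \<open>alpha\<close> with denominators cleared; it trades
      the weight \<open>1 - p\<close> for \<open>p\<close>.\<close>
    have p: "p = alpha p * alpha p * (1 - p)"
      using assms by (simp add: alpha_def)
    have "2 * p * (1 / (\<sigma> * alpha p)) = 2 * (alpha p * alpha p * (1 - p)) * (1 / (\<sigma> * alpha p))"
      using p by simp
    also have "\<dots> = beta \<sigma> p"
      using assms alpha_pos[OF assms(2)] by (simp add: beta_eq)
    finally show ?thesis ..
  qed
  show ?thesis
  proof (cases "x \<ge> \<mu>")
    case True
    then have "psi \<mu> \<sigma> p x = beta \<sigma> p * std_normal_density ((x - \<mu>) / (\<sigma> / alpha p))"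
      by (simp add: psi_def divide_inverse)
    with True show ?thesis
      unfolding right by (simp add: phi_def)
  next
    case False
    then have "psi \<mu> \<sigma> p x = beta \<sigma> p * std_normal_density ((x - \<mu>) / (\<sigma> * alpha p))"
      by (simp add: psi_def)
    with False show ?thesis
      unfolding left by (simp add: phi_def)
  qed
qed

text \<open>The form in \<open>phi\<close> serves the mixture identity; this one connects to the
  half-mass lemmas for the two integrals.\<close>

lemma psi_eq_normal_density:
  assumes "\<sigma> > 0" "p \<in> {0<..<1}"
  shows "psi \<mu> \<sigma> p x =
    (if x \<ge> \<mu> then 2 * (1 - p) * normal_density \<mu> (\<sigma> / alpha p) x
     else 2 * p * normal_density \<mu> (\<sigma> * alpha p) x)"
  using assms alpha_pos[OF assms(2)] by (simp add: psi_eq_phi phi_eq_normal_density)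

text \<open>Exchanging integrands that agree almost everywhere asks for measurability of
  both.\<close>

lemma borel_measurable_psi [measurable]: "psi \<mu> \<sigma> p \<in> borel_measurable borel"
proof -
  have "(\<lambda>x. psi \<mu> \<sigma> p x) \<in> borel_measurable borel"
    unfolding psi_def by measurable
  then show ?thesis .
qed

text \<open>Each branch is a continuous function whose argument vanishes at \<mu>, and both carry
  the same factor \<open>beta\<close>; hence the same limit on either side.\<close>

lemma psi_tendsto_at_right:
  "(psi \<mu> \<sigma> p \<longlongrightarrow> beta \<sigma> p * std_normal_density 0) (at_right \<mu>)"
proof -
  \<comment> \<open>Multiplying by \<open>inverse\<close> instead of dividing keeps the limit rules
    free of a nonzero condition on the scale.\<close>
  have "((\<lambda>x. beta \<sigma> p * std_normal_density ((x - \<mu>) * inverse (\<sigma> * inverse (alpha p))))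
      \<longlongrightarrow> beta \<sigma> p * std_normal_density ((\<mu> - \<mu>) * inverse (\<sigma> * inverse (alpha p)))) (at_right \<mu>)"
    unfolding std_normal_density_def by (intro tendsto_intros) auto
  moreover have "\<forall>\<^sub>F x in at_right \<mu>. psi \<mu> \<sigma> p x =
      beta \<sigma> p * std_normal_density ((x - \<mu>) * inverse (\<sigma> * inverse (alpha p)))"
    by (auto simp: psi_def divide_inverse eventually_at_filter)
  ultimately show ?thesis
    by (simp add: tendsto_cong)
qed

lemma psi_tendsto_at_left:
  "(psi \<mu> \<sigma> p \<longlongrightarrow> beta \<sigma> p * std_normal_density 0) (at_left \<mu>)"
proof -
  have "((\<lambda>x. beta \<sigma> p * std_normal_density ((x - \<mu>) * inverse (\<sigma> * alpha p)))
      \<longlongrightarrow> beta \<sigma> p * std_normal_density ((\<mu> - \<mu>) * inverse (\<sigma> * alpha p))) (at_left \<mu>)"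
    unfolding std_normal_density_def by (intro tendsto_intros) auto
  moreover have "\<forall>\<^sub>F x in at_left \<mu>. psi \<mu> \<sigma> p x =
      beta \<sigma> p * std_normal_density ((x - \<mu>) * inverse (\<sigma> * alpha p))"
    by (auto simp: psi_def divide_inverse eventually_at_filter)
  ultimately show ?thesis
    by (simp add: tendsto_cong)
qed

lemma has_bochner_integral_psi_atMost:
  assumes "\<sigma> > 0" "p \<in> {0<..<1}"
  shows "has_bochner_integral lborel (\<lambda>x. indicator {..\<mu>} x * psi \<mu> \<sigma> p x) p"
proof -
  have "has_bochner_integral lborel
      (\<lambda>x. 2 * p * (indicator {..\<mu>} x * normal_density \<mu> (\<sigma> * alpha p) x)) (2 * p * (1 / 2))"
    using assms alpha_pos[OF assms(2)]
    by (intro has_bochner_integral_mult_right has_bochner_integral_normal_density_atMost) simp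
  \<comment> \<open>The set \<open>{..\<mu>}\<close> contains \<mu>, where \<open>psi\<close> takes
    its right branch; the null set of this one point is left out.\<close>
  moreover have "AE x in lborel. indicator {..\<mu>} x * psi \<mu> \<sigma> p x =
      2 * p * (indicator {..\<mu>} x * normal_density \<mu> (\<sigma> * alpha p) x)"
    using AE_lborel_singleton[of \<mu>]
    by eventually_elim (auto simp: psi_eq_normal_density[OF assms] indicator_def)
  ultimately show ?thesis
    by (subst has_bochner_integral_cong_AE) auto
qed

text \<open>The left mass \<open>p\<close> is added to the right mass
  \<open>2 * (1 - p) * (1 / 2)\<close>.\<close>

lemma has_bochner_integral_psi:
  assumes "\<sigma> > 0" "p \<in> {0<..<1}"
  shows "has_bochner_integral lborel (psi \<mu> \<sigma> p) 1"
proof -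
  have "has_bochner_integral lborel
      (\<lambda>x. 2 * (1 - p) * (indicator {\<mu>..} x * normal_density \<mu> (\<sigma> / alpha p) x))
      (2 * (1 - p) * (1 / 2))"
    using assms alpha_pos[OF assms(2)]
    by (intro has_bochner_integral_mult_right has_bochner_integral_normal_density_atLeast) simp
  from has_bochner_integral_add[OF has_bochner_integral_psi_atMost[OF assms, of \<mu>] this]
  have "has_bochner_integral lborel (\<lambda>x. indicator {..\<mu>} x * psi \<mu> \<sigma> p x +
      2 * (1 - p) * (indicator {\<mu>..} x * normal_density \<mu> (\<sigma> / alpha p) x)) 1"
    by (simp add: diff_divide_distrib)
  \<comment> \<open>At \<mu> both indicators are 1 and the sum counts the value twice, so equality
    holds only off this point.\<close>
  moreover have "AE x in lborel. psi \<mu> \<sigma> p x = indicator {..\<mu>} x * psi \<mu> \<sigma> p x +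
      2 * (1 - p) * (indicator {\<mu>..} x * normal_density \<mu> (\<sigma> / alpha p) x)"
    using AE_lborel_singleton[of \<mu>]
    by eventually_elim (auto simp: psi_eq_normal_density[OF assms] indicator_def)
  ultimately show ?thesis
    by (subst has_bochner_integral_cong_AE) auto
qed

theorem theorem5:
  "(\<forall>\<mu>. \<forall>\<sigma>>0. \<forall>p\<in>{0<..<1}.
      \<exists>L. (psi \<mu> \<sigma> p \<longlongrightarrow> L) (at_right \<mu>) \<and> (psi \<mu> \<sigma> p \<longlongrightarrow> L) (at_left \<mu>)) \<and>
   (\<exists>\<Theta>m \<in> UNIV \<times> {0<..} \<times> {0<..<1} \<rightarrow> UNIV \<times> {0<..}.
    \<exists>\<Theta>p \<in> UNIV \<times> {0<..} \<times> {0<..<1} \<rightarrow> UNIV \<times> {0<..}.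
    \<exists>Z>0. \<forall>x \<mu>. \<forall>\<sigma>>0. \<forall>p\<in>{0<..<1}.
      psi \<mu> \<sigma> p x * Z =
        p * phi x (\<Theta>m (\<mu>, \<sigma>, p)) * of_bool (x < \<mu>)
        + (1 - p) * phi x (\<Theta>p (\<mu>, \<sigma>, p)) * of_bool (x \<ge> \<mu>)) \<and>
   (\<forall>\<mu>. \<forall>\<sigma>>0. \<forall>p\<in>{0<..<1}.
      integrable lborel (psi \<mu> \<sigma> p) \<and> (LBINT x. psi \<mu> \<sigma> p x) = 1) \<and>
   (\<forall>\<mu>. \<forall>\<sigma>>0. \<forall>p\<in>{0<..<1}.
      (LBINT x:{..\<mu>}. psi \<mu> \<sigma> p x) = p)"
proof (intro conjI)
  show "\<forall>\<mu>. \<forall>\<sigma>>0. \<forall>p\<in>{0<..<1}.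
      \<exists>L. (psi \<mu> \<sigma> p \<longlongrightarrow> L) (at_right \<mu>) \<and> (psi \<mu> \<sigma> p \<longlongrightarrow> L) (at_left \<mu>)"
    using psi_tendsto_at_right psi_tendsto_at_left by blast
next
  \<comment> \<open>Both components keep the mode \<mu>; the deviations are those of
    \<open>psi_eq_phi\<close>, positive by \<open>alpha_pos\<close>.\<close>
  let ?\<Theta>m = "\<lambda>(\<mu>, \<sigma>, p). (\<mu> :: real, \<sigma> * alpha p)"
  let ?\<Theta>p = "\<lambda>(\<mu>, \<sigma>, p). (\<mu> :: real, \<sigma> / alpha p)"
  have m: "?\<Theta>m \<in> UNIV \<times> {0<..} \<times> {0<..<1} \<rightarrow> UNIV \<times> {0<..}"
    and p: "?\<Theta>p \<in> UNIV \<times> {0<..} \<times> {0<..<1} \<rightarrow> UNIV \<times> {0<..}"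
    using alpha_pos by auto
  show "\<exists>\<Theta>m \<in> UNIV \<times> {0<..} \<times> {0<..<1} \<rightarrow> UNIV \<times> {0<..}.
    \<exists>\<Theta>p \<in> UNIV \<times> {0<..} \<times> {0<..<1} \<rightarrow> UNIV \<times> {0<..}.
    \<exists>Z>0. \<forall>x \<mu>. \<forall>\<sigma>>0. \<forall>p\<in>{0<..<1}.
      psi \<mu> \<sigma> p x * Z =
        p * phi x (\<Theta>m (\<mu>, \<sigma>, p)) * of_bool (x < \<mu>)
        + (1 - p) * phi x (\<Theta>p (\<mu>, \<sigma>, p)) * of_bool (x \<ge> \<mu>)"
    by (rule bexI[OF _ m], rule bexI[OF _ p], rule exI[of _ "1 / 2"]) (auto simp: psi_eq_phi)
next
  show "\<forall>\<mu>. \<forall>\<sigma>>0. \<forall>p\<in>{0<..<1}.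
      integrable lborel (psi \<mu> \<sigma> p) \<and> (LBINT x. psi \<mu> \<sigma> p x) = 1"
    using has_bochner_integral_psi by (auto simp: has_bochner_integral_iff)
next
  \<comment> \<open>The set integral unfolds to the integral of the indicator times
    \<open>psi\<close>, the form in which the left mass was computed.\<close>
  show "\<forall>\<mu>. \<forall>\<sigma>>0. \<forall>p\<in>{0<..<1}. (LBINT x:{..\<mu>}. psi \<mu> \<sigma> p x) = p"
    using has_bochner_integral_psi_atMost
    by (auto simp: has_bochner_integral_iff set_lebesgue_integral_def)
qed

end
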